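(* Consider observations $y_{ij}=\mu_i+\epsilon_{ij}$, $i=1,\ldots,p$, $j=1,\ldots,r$, with $\epsilon_{ij}$ i.i.d. $N(0,1)$, and the two models $M_1:\mu=0$ and $M_2:\mu=(\mu_1,\ldots,\mu_p)\in\mathbb{R}^p$, with a prior density $\pi$ on $\mu$ under $M_2$. Let $1\le k<r$ and let $$\log CVBF^{ps}_{21}=\frac p2\Big[(rC_p-kC'_p)-\log\frac rk\Big],\qquad C_p=\frac1p\sum_{i=1}^p\Big[\frac1r\sum_{j=1}^r y_{ij}\Big]^2,\quad C'_p=\frac1p\sum_{i=1}^p\Big[\frac1k\sum_{j=1}^k y_{ij}\Big]^2 .$$ Assume: (Assumption 1) $\pi(\hat\mu_k)-\pi(\hat\mu_r)=o_p(1)$ as $k\to\infty$, $r\to\infty$, where $\hat\mu_k$ and $\hat\mu_r$ are the maximum likelihood estimators of $\mu$ based on $k$ and on $r$ replicates, respectively; (Assumption 2) under $M_2$, $\lim_{p\to\infty}\frac1p\sum_{i=1}^p\mu_i^2=\tau^2>0$. Let $p,k,r\to\infty$ with $k/r\to c$. Then for every $0\le c<1$, $\log CVBF^{ps}_{21}$ chooses the correct model with probability tending to one, both under $M_1$ and under $M_2$; that is, $P(\log CVBF^{ps}_{21}<0)\to1$ when $M_1$ is true, and $P(\log CVBF^{ps}_{21}>0)\to1$ when $M_2$ is true.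
   Context: The true parameter is non-random: under $M_1$ all $\mu_i=0$; under $M_2$ the data are generated from a fixed sequence $\mu_1,\mu_2,\ldots$ satisfying Assumption 2. The maximum likelihood estimators are the vectors of group means: $\hat\mu_k=\big(\frac1k\sum_{j=1}^k y_{ij}\big)_{i=1}^p$ and $\hat\mu_r=\big(\frac1r\sum_{j=1}^r y_{ij}\big)_{i=1}^p$. The quantity $CVBF^{ps}_{21}$ ("ps" for pseudo) is a proxy for the cross-validatory Bayes factor $CVBF_{21}=BF^r_{21}/BF^k_{21}$, in which $k$ out of the $r$ replicates for each $\mu_i$ are used to make the prior proper; $BF^s_{21}$ denotes the Bayes factor of $M_2$ against $M_1$ based on $s$ replicates per group. For the theorem, $\log CVBF^{ps}_{21}$ is defined by the explicit formula in the statement. Decision rule: choose $M_2$ if $\log CVBF^{ps}_{21}>0$ and choose $M_1$ if $\log CVBF^{ps}_{21}<0$. *)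

theory Defs
  imports "HOL-Probability.Probability"
begin

text \<open>
  Observations are random variables \<open>y i j\<close> with group index \<open>i\<close> and replicate index \<open>j\<close>, both
  starting at 1.  The errors form one infinite array; \<open>p\<close> groups with \<open>r\<close> replicates use the
  entries with \<open>1 \<le> i \<le> p\<close> and \<open>1 \<le> j \<le> r\<close>.
\<close>

definition iid_std_normal_errors :: "'a measure \<Rightarrow> (nat \<Rightarrow> nat \<Rightarrow> 'a \<Rightarrow> real) \<Rightarrow> bool" where
  "iid_std_normal_errors M eps \<longleftrightarrow>
     prob_space.indep_vars M (\<lambda>_. borel) (\<lambda>(i, j). eps i j) ({1..} \<times> {1..}) \<and>
     (\<forall>i\<ge>1. \<forall>j\<ge>1. distributed M lborel (eps i j) (normal_density 0 1))"

definition group_mean :: "(nat \<Rightarrow> nat \<Rightarrow> 'a \<Rightarrow> real) \<Rightarrow> nat \<Rightarrow> nat \<Rightarrow> 'a \<Rightarrow> real" where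
  "group_mean y s i \<omega> = (1 / real s) * (\<Sum>j=1..s. y i j \<omega>)"

text \<open>
  A vector in \<open>\<real>\<^sup>p\<close> is a function on \<open>{1..p}\<close> in the sense of \<^term>\<open>extensional\<close>, because the
  dimension \<open>p\<close> varies; Lebesgue measure on \<open>\<real>\<^sup>p\<close> is the corresponding product measure.
  The maximum likelihood estimator of the mean vector from \<open>s\<close> replicates per group is the
  vector of group means.
\<close>

definition mle :: "(nat \<Rightarrow> nat \<Rightarrow> 'a \<Rightarrow> real) \<Rightarrow> nat \<Rightarrow> nat \<Rightarrow> 'a \<Rightarrow> (nat \<Rightarrow> real)" where
  "mle y p s \<omega> = (\<lambda>i\<in>{1..p}. group_mean y s i \<omega>)"

text \<open>Improper priors are allowed, so the total mass may differ from 1 and may be infinite.\<close>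

definition prior_density :: "nat \<Rightarrow> ((nat \<Rightarrow> real) \<Rightarrow> real) \<Rightarrow> bool" where
  "prior_density p \<pi> \<longleftrightarrow>
     \<pi> \<in> borel_measurable (Pi\<^sub>M {1..p} (\<lambda>_. lborel)) \<and>
     (\<forall>m \<in> space (Pi\<^sub>M {1..p} (\<lambda>_. lborel)). 0 \<le> \<pi> m) \<and>
     (\<integral>\<^sup>+m. ennreal (\<pi> m) \<partial>(Pi\<^sub>M {1..p} (\<lambda>_. lborel))) > 0"

definition little_op_1 :: "'a measure \<Rightarrow> (nat \<Rightarrow> 'a \<Rightarrow> real) \<Rightarrow> bool" where
  "little_op_1 M X \<longleftrightarrow>
     (\<forall>\<delta>>0. (\<lambda>n. \<P>(\<omega> in M. \<bar>X n \<omega>\<bar> > \<delta>)) \<longlonglongrightarrow> 0)"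

definition mean_square_mle :: "(nat \<Rightarrow> nat \<Rightarrow> 'a \<Rightarrow> real) \<Rightarrow> nat \<Rightarrow> nat \<Rightarrow> 'a \<Rightarrow> real" where
  "mean_square_mle y p s \<omega> = (1 / real p) * (\<Sum>i=1..p. (group_mean y s i \<omega>)\<^sup>2)"

definition log_CVBF_ps ::
    "(nat \<Rightarrow> nat \<Rightarrow> 'a \<Rightarrow> real) \<Rightarrow> nat \<Rightarrow> nat \<Rightarrow> nat \<Rightarrow> 'a \<Rightarrow> real" where
  "log_CVBF_ps y p k r \<omega> =
     (real p / 2) *
       ((real r * mean_square_mle y p r \<omega> - real k * mean_square_mle y p k \<omega>)
        - ln (real r / real k))"

end

theory Submission
  imports Defs "HOL-Real_Asymp.Real_Asymp"
begin

text \<open>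
  Write \<open>Z\<^sub>s\<^sub>,\<^sub>i\<close> for the error sum of group \<open>i\<close> over \<open>s\<close> replicates divided by \<open>sqrt s\<close>, a
  standard normal variable, independent over \<open>i\<close>.  With \<open>s\<close> replicates, \<open>s\<close> times the mean
  square of the group means is \<open>s m + 2 sqrt s U + V\<close>, where \<open>m\<close>, \<open>U\<close>, \<open>V\<close> are the averages over
  the \<open>p\<close> groups of \<open>\<mu>\<^sub>i\<^sup>2\<close>, \<open>\<mu>\<^sub>i Z\<^sub>s\<^sub>,\<^sub>i\<close>, \<open>Z\<^sub>s\<^sub>,\<^sub>i\<^sup>2\<close>.  By Chebyshev's inequality \<open>U\<close> tends to 0 and
  \<open>V\<close> tends to 1 in probability, for \<open>s = k\<close> and for \<open>s = r\<close>, without any condition on the joint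
  law of the two.  If all \<open>\<mu>\<^sub>i\<close> vanish, only the difference of the \<open>V\<close>'s competes with \<open>ln (r / k)\<close>,
  which stays away from 0 because \<open>c < 1\<close>.  Otherwise \<open>(r - k) m\<close> has order at least \<open>r\<close> and dominates
  the remaining terms of order \<open>sqrt r\<close>, 1 and \<open>ln r\<close>.
\<close>

section \<open>Second moments and convergence in probability\<close>

lemma (in prob_space) second_moment_sum_indep:
  fixes X :: "'i \<Rightarrow> 'a \<Rightarrow> real"
  assumes "finite I" and "indep_vars (\<lambda>_. borel) X I"
    and "\<And>i. i \<in> I \<Longrightarrow> integrable M (\<lambda>\<omega>. (X i \<omega>)\<^sup>2)"
    and "\<And>i. i \<in> I \<Longrightarrow> expectation (X i) = 0"
  shows "integrable M (\<lambda>\<omega>. (\<Sum>i\<in>I. X i \<omega>)\<^sup>2) \<and>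
    expectation (\<lambda>\<omega>. (\<Sum>i\<in>I. X i \<omega>)\<^sup>2) = (\<Sum>i\<in>I. expectation (\<lambda>\<omega>. (X i \<omega>)\<^sup>2))"
  using assms
proof (induction I rule: finite_induct)
  case (insert i I)
  let ?S = "\<lambda>\<omega>. \<Sum>j\<in>I. X j \<omega>"
  have "indep_vars (\<lambda>_. borel) X I"
    using insert.prems(1) by (rule indep_vars_subset) auto
  then have IH: "integrable M (\<lambda>\<omega>. (?S \<omega>)\<^sup>2)"
      "expectation (\<lambda>\<omega>. (?S \<omega>)\<^sup>2) = (\<Sum>j\<in>I. expectation (\<lambda>\<omega>. (X j \<omega>)\<^sup>2))"
    using insert.IH insert.prems by auto
  have rv [measurable]: "random_variable borel (X j)" if "j \<in> insert i I" for j
    using insert.prems(1) that by (auto simp: indep_vars_def)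
  have [measurable]: "random_variable borel (X i)" "random_variable borel ?S"
    using rv by (auto intro!: borel_measurable_sum)
  have int: "integrable M (X i)" "integrable M ?S"
    using square_integrable_imp_integrable[of "X i"] square_integrable_imp_integrable[of ?S]
      insert.prems(2) IH(1) by auto
  \<comment> \<open>The new summand is independent of the sum of the others, so the expectation of
    the cross term factors and vanishes because \<open>X i\<close> is centred.\<close>
  have ind: "indep_var borel (X i) borel ?S"
    using insert by (intro indep_vars_sum) auto
  have cross: "integrable M (\<lambda>\<omega>. X i \<omega> * ?S \<omega>)" "expectation (\<lambda>\<omega>. X i \<omega> * ?S \<omega>) = 0"
    using indep_var_integrable[OF ind int] indep_var_lebesgue_integral[OF ind int] insert.prems(3)
    by auto
  have eq: "(\<lambda>\<omega>. (\<Sum>j\<in>insert i I. X j \<omega>)\<^sup>2) =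
      (\<lambda>\<omega>. ((X i \<omega>)\<^sup>2 + (?S \<omega>)\<^sup>2) + 2 * (X i \<omega> * ?S \<omega>))"
    using insert.hyps by (auto simp: power2_sum)
  show ?case
    unfolding eq using insert.prems(2) insert.hyps IH cross by simp
qed simp

text \<open>Chebyshev's inequality for an average of centred independent variables. The summands may
  have different variances, which the weights \<mu> later require.\<close>

lemma (in prob_space) weak_law_bound:
  fixes X :: "nat \<Rightarrow> 'a \<Rightarrow> real"
  assumes indep: "indep_vars (\<lambda>_. borel) X {1..p}"
    and sq: "\<And>i. i \<in> {1..p} \<Longrightarrow> integrable M (\<lambda>\<omega>. (X i \<omega>)\<^sup>2)"
    and mean: "\<And>i. i \<in> {1..p} \<Longrightarrow> expectation (X i) = 0"
    and "\<delta> > 0"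
  shows "prob {\<omega>\<in>space M. \<bar>(1 / real p) * (\<Sum>i=1..p. X i \<omega>)\<bar> \<ge> \<delta>}
    \<le> (\<Sum>i=1..p. expectation (\<lambda>\<omega>. (X i \<omega>)\<^sup>2)) / (real p * \<delta>)\<^sup>2"
proof (cases "p = 0")
  case False
  have [measurable]: "random_variable borel (X i)" if "i \<in> {1..p}" for i
    using indep that by (auto simp: indep_vars_def)
  have rv: "random_variable borel (\<lambda>\<omega>. \<Sum>i=1..p. X i \<omega>)"
    by measurable
  have set_eq: "{\<omega>\<in>space M. \<bar>(1 / real p) * (\<Sum>i=1..p. X i \<omega>)\<bar> \<ge> \<delta>} =
      {\<omega>\<in>space M. \<bar>\<Sum>i=1..p. X i \<omega>\<bar> \<ge> real p * \<delta>}"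
    using False by (auto simp: abs_mult field_simps)
  show ?thesis
    unfolding set_eq
    using second_moment_method[OF rv, of "real p * \<delta>"]
      second_moment_sum_indep[OF _ indep sq mean] False \<open>\<delta> > 0\<close> by auto
\<comment> \<open>For \<open>p = 0\<close> both sides are 0: the average is 0, hence the event
  empty, and the bound is an empty sum divided by zero.\<close>
qed (use \<open>\<delta> > 0\<close> in simp)

lemma (in prob_space) prob_Un_tendsto_0:
  assumes "(\<lambda>n. prob (A n)) \<longlonglongrightarrow> 0" "(\<lambda>n. prob (B n)) \<longlonglongrightarrow> 0"
    and "\<And>n. A n \<in> events" "\<And>n. B n \<in> events"
  shows "(\<lambda>n. prob (A n \<union> B n)) \<longlonglongrightarrow> 0"
proof (rule tendsto_sandwich[OF _ _ tendsto_const])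
  show "(\<lambda>n. prob (A n) + prob (B n)) \<longlonglongrightarrow> 0"
    using tendsto_add[OF assms(1,2)] by simp
  show "\<forall>\<^sub>F n in sequentially. prob (A n \<union> B n) \<le> prob (A n) + prob (B n)"
    using assms(3,4) by (intro always_eventually allI measure_Un_le) auto
qed simp

text \<open>Reduces consistency to a pointwise argument off a bad event of vanishing probability.
  The inclusion is asked only for large \<open>n\<close>, since the estimates on \<open>p\<close>,
  \<open>k / r\<close> and \<open>r\<close> hold only eventually.\<close>

lemma (in prob_space) prob_tendsto_1:
  assumes B: "(\<lambda>n. prob (B n)) \<longlonglongrightarrow> 0" "\<And>n. B n \<in> events"
    and E: "\<And>n. E n \<in> events" "\<forall>\<^sub>F n in sequentially. space M - B n \<subseteq> E n"
  shows "(\<lambda>n. prob (E n)) \<longlonglongrightarrow> 1"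
proof (rule tendsto_sandwich[OF _ _ _ tendsto_const])
  show "(\<lambda>n. 1 - prob (B n)) \<longlonglongrightarrow> 1"
    using tendsto_diff[OF tendsto_const B(1), of 1] by simp
  show "\<forall>\<^sub>F n in sequentially. 1 - prob (B n) \<le> prob (E n)"
    using E(2)
  proof eventually_elim
    case (elim n)
    then have "prob (space M - B n) \<le> prob (E n)"
      using E(1) by (intro finite_measure_mono)
    then show ?case
      using prob_compl[OF B(2)] by simp
  qed
qed simp

section \<open>Standardised error sums and their moments\<close>

definition std_error_sum :: "(nat \<Rightarrow> nat \<Rightarrow> 'a \<Rightarrow> real) \<Rightarrow> nat \<Rightarrow> nat \<Rightarrow> 'a \<Rightarrow> real" where
  "std_error_sum eps s i \<omega> = (\<Sum>j=1..s. eps i j \<omega>) / sqrt (real s)"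

lemma (in prob_space) std_error_sum_std_normal:
  assumes "iid_std_normal_errors M eps" and "s \<ge> 1" and "i \<ge> 1"
  shows "distributed M lborel (std_error_sum eps s i) std_normal_density"
proof -
  have ind: "indep_vars (\<lambda>_. borel) (\<lambda>(i, j). eps i j) ({1..} \<times> {1..})"
    and dist: "\<And>j. j \<ge> 1 \<Longrightarrow> distributed M lborel (eps i j) (normal_density 0 1)"
    using assms by (auto simp: iid_std_normal_errors_def)
  \<comment> \<open>The replicates of group \<open>i\<close> are taken as a set of index pairs, so
    that independence of the whole array restricts to them. The variances add up to
    \<open>s\<close>, and dividing by \<open>sqrt s\<close> standardises the sum.\<close>
  let ?I = "{i} \<times> {1..s}"
  have "indep_vars (\<lambda>_. borel) (\<lambda>(i, j). eps i j) ?I"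
    using ind by (rule indep_vars_subset) (use \<open>i \<ge> 1\<close> in auto)
  then have "distributed M lborel (\<lambda>\<omega>. \<Sum>x\<in>?I. (\<lambda>(i, j). eps i j) x \<omega>)
      (normal_density (\<Sum>x\<in>?I. 0) (sqrt (\<Sum>x\<in>?I. 1\<^sup>2)))"
    by (intro sum_indep_normal) (use assms dist in auto)
  moreover have "(\<Sum>x\<in>?I. (\<lambda>(i, j). eps i j) x \<omega>) = (\<Sum>j=1..s. eps i j \<omega>)" for \<omega>
    by (rule sum.reindex_bij_witness[of _ "Pair i" snd]) auto
  ultimately have "distributed M lborel (\<lambda>\<omega>. \<Sum>j=1..s. eps i j \<omega>) (normal_density 0 (sqrt (real s)))"
    by (simp add: card_cartesian_product)
  then show ?thesis
    using \<open>s \<ge> 1\<close> normal_standard_normal_convert[of "sqrt (real s)"]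
    by (simp add: std_error_sum_def[abs_def])
qed

text \<open>Different groups use disjoint blocks of the error array, and each sum is a measurable
  function of its own block.\<close>

lemma (in prob_space) std_error_sum_indep:
  assumes "iid_std_normal_errors M eps"
  shows "indep_vars (\<lambda>_. borel) (std_error_sum eps s) {1..p}"
proof -
  let ?K = "\<lambda>i::nat. {i} \<times> {1..s}"
  have ind: "indep_vars (\<lambda>_. borel) (\<lambda>(i, j). eps i j) ({1..} \<times> {1..})"
    using assms by (simp add: iid_std_normal_errors_def)
  have "indep_vars (\<lambda>i. PiM (?K i) (\<lambda>_. borel))
      (\<lambda>i \<omega>. restrict (\<lambda>x. (\<lambda>(i, j). eps i j) x \<omega>) (?K i)) {1..p}"
    using ind by (rule indep_vars_restrict) (auto simp: disjoint_family_on_def)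
  then have "indep_vars (\<lambda>_. borel)
      (\<lambda>i \<omega>. (\<lambda>f. (\<Sum>j=1..s. f (i, j)) / sqrt (real s))
        (restrict (\<lambda>x. (\<lambda>(i, j). eps i j) x \<omega>) (?K i))) {1..p}"
    by (rule indep_vars_compose2) auto
  then show ?thesis
    by (simp add: std_error_sum_def[abs_def])
qed

lemma (in prob_space) std_normal_moments:
  assumes "distributed M lborel X std_normal_density"
  shows "integrable M (\<lambda>\<omega>. X \<omega> ^ m)"
    and "expectation (\<lambda>\<omega>. X \<omega> ^ (2 * n)) = fact (2 * n) / (2 ^ n * fact n)"
  using distributed_integrable[OF assms, of "\<lambda>x. x ^ m"] integrable_std_normal_moment[of m]
    distributed_integral[OF assms, of "\<lambda>x. x ^ (2 * n)"] integral_std_normal_moment_even[of n]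
  by auto

lemma (in prob_space) chi_square_deviation_moments:
  assumes "distributed M lborel X std_normal_density"
  shows "integrable M (\<lambda>\<omega>. ((X \<omega>)\<^sup>2 - 1)\<^sup>2)"
    and "expectation (\<lambda>\<omega>. (X \<omega>)\<^sup>2 - 1) = 0"
    and "expectation (\<lambda>\<omega>. ((X \<omega>)\<^sup>2 - 1)\<^sup>2) = 2"
proof -
  note int = std_normal_moments(1)[OF assms]
  \<comment> \<open>The even moment formula at \<open>n = 1\<close> and \<open>n = 2\<close> gives 1
    and 3, hence the variance 3 - 2 + 1 = 2 of the squared variable.\<close>
  have E: "expectation (\<lambda>\<omega>. (X \<omega>)\<^sup>2) = 1" "expectation (\<lambda>\<omega>. X \<omega> ^ 4) = 3"
    using std_normal_moments(2)[OF assms, of 1] std_normal_moments(2)[OF assms, of 2]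
    by (simp_all add: fact_numeral)
  have eq: "((X \<omega>)\<^sup>2 - 1)\<^sup>2 = X \<omega> ^ 4 - 2 * (X \<omega>)\<^sup>2 + 1" for \<omega>
    by (simp add: power2_eq_square power4_eq_xxxx algebra_simps)
  show "integrable M (\<lambda>\<omega>. ((X \<omega>)\<^sup>2 - 1)\<^sup>2)" "expectation (\<lambda>\<omega>. (X \<omega>)\<^sup>2 - 1) = 0"
    "expectation (\<lambda>\<omega>. ((X \<omega>)\<^sup>2 - 1)\<^sup>2) = 2"
    unfolding eq using int E by (simp_all add: prob_space)
qed

section \<open>Weak laws of large numbers over the groups\<close>

lemma (in prob_space) mean_square_errors_concentrate:
  assumes errors: "iid_std_normal_errors M eps" and s: "\<And>n. s n \<ge> 1"
    and p: "filterlim p at_top sequentially" and "\<delta> > 0"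
  shows "(\<lambda>n. prob {\<omega>\<in>space M.
    \<bar>(1 / real (p n)) * (\<Sum>i=1..p n. (std_error_sum eps (s n) i \<omega>)\<^sup>2 - 1)\<bar> \<ge> \<delta>}) \<longlonglongrightarrow> 0"
proof (rule tendsto_sandwich[OF _ _ tendsto_const])
  have "filterlim (\<lambda>n. real (p n)) at_top sequentially"
    using p by (rule filterlim_compose[OF filterlim_real_sequentially])
  \<comment> \<open>The Chebyshev bound, 2 over \<open>p\<close> times the square of \<delta>, does
    not involve \<open>s\<close>; the growth of \<open>p\<close> alone drives the
    convergence.\<close>
  moreover have "((\<lambda>x::real. x * 2 / (x * \<delta>)\<^sup>2) \<longlongrightarrow> 0) at_top"
    using \<open>\<delta> > 0\<close> by real_asymp
  ultimately show "(\<lambda>n. real (p n) * 2 / (real (p n) * \<delta>)\<^sup>2) \<longlonglongrightarrow> 0"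
    by (rule filterlim_compose[rotated])
  show "\<forall>\<^sub>F n in sequentially. prob {\<omega>\<in>space M.
      \<bar>(1 / real (p n)) * (\<Sum>i=1..p n. (std_error_sum eps (s n) i \<omega>)\<^sup>2 - 1)\<bar> \<ge> \<delta>}
      \<le> real (p n) * 2 / (real (p n) * \<delta>)\<^sup>2"
  proof (intro always_eventually allI)
    fix n
    have ind: "indep_vars (\<lambda>_. borel) (\<lambda>i \<omega>. (std_error_sum eps (s n) i \<omega>)\<^sup>2 - 1) {1..p n}"
      using std_error_sum_indep[OF errors] by (rule indep_vars_compose2) auto
    note mom = chi_square_deviation_moments[OF std_error_sum_std_normal[OF errors s]]
    show "prob {\<omega>\<in>space M.
        \<bar>(1 / real (p n)) * (\<Sum>i=1..p n. (std_error_sum eps (s n) i \<omega>)\<^sup>2 - 1)\<bar> \<ge> \<delta>}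
        \<le> real (p n) * 2 / (real (p n) * \<delta>)\<^sup>2"
      using weak_law_bound[OF ind _ _ \<open>\<delta> > 0\<close>] mom by simp
  qed
qed simp

text \<open>The summands have variances \<open>(\<mu> i)\<^sup>2\<close>, so the Chebyshev bound is
  the average of these squares times \<open>1 / p\<close>, up to a constant: a convergent sequence
  times a null sequence.\<close>

lemma (in prob_space) weighted_mean_errors_concentrate:
  assumes errors: "iid_std_normal_errors M eps" and s: "\<And>n. s n \<ge> 1"
    and p: "filterlim p at_top sequentially" and "\<delta> > 0"
    and lim: "(\<lambda>d. (1 / real d) * (\<Sum>i=1..d. (\<mu> i)\<^sup>2)) \<longlonglongrightarrow> L"
  shows "(\<lambda>n. prob {\<omega>\<in>space M.
    \<bar>(1 / real (p n)) * (\<Sum>i=1..p n. \<mu> i * std_error_sum eps (s n) i \<omega>)\<bar> \<ge> \<delta>}) \<longlonglongrightarrow> 0"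
proof (rule tendsto_sandwich[OF _ _ tendsto_const])
  let ?m = "\<lambda>d. (1 / real d) * (\<Sum>i=1..d. (\<mu> i)\<^sup>2)"
  have "(\<lambda>n. 1 / real (p n)) \<longlonglongrightarrow> 0"
    using filterlim_compose[OF lim_1_over_n p] by (simp add: o_def)
  from tendsto_mult[OF filterlim_compose[OF lim p] this]
  have "(\<lambda>n. ?m (p n) * (1 / real (p n)) / \<delta>\<^sup>2) \<longlonglongrightarrow> 0"
    using tendsto_divide_zero by fastforce
  then show "(\<lambda>n. (\<Sum>i=1..p n. (\<mu> i)\<^sup>2) / (real (p n) * \<delta>)\<^sup>2) \<longlonglongrightarrow> 0"
    by (simp add: power2_eq_square mult_ac)
  show "\<forall>\<^sub>F n in sequentially. prob {\<omega>\<in>space M.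
      \<bar>(1 / real (p n)) * (\<Sum>i=1..p n. \<mu> i * std_error_sum eps (s n) i \<omega>)\<bar> \<ge> \<delta>}
      \<le> (\<Sum>i=1..p n. (\<mu> i)\<^sup>2) / (real (p n) * \<delta>)\<^sup>2"
  proof (intro always_eventually allI)
    fix n
    have ind: "indep_vars (\<lambda>_. borel) (\<lambda>i \<omega>. \<mu> i * std_error_sum eps (s n) i \<omega>) {1..p n}"
      using std_error_sum_indep[OF errors] by (rule indep_vars_compose2) auto
    have mom: "integrable M (\<lambda>\<omega>. (\<mu> i * std_error_sum eps (s n) i \<omega>)\<^sup>2)"
        "expectation (\<lambda>\<omega>. \<mu> i * std_error_sum eps (s n) i \<omega>) = 0"
        "expectation (\<lambda>\<omega>. (\<mu> i * std_error_sum eps (s n) i \<omega>)\<^sup>2) = (\<mu> i)\<^sup>2" if "i \<ge> 1" for i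
    proof -
      note D = std_error_sum_std_normal[OF errors s[of n] that]
      show "integrable M (\<lambda>\<omega>. (\<mu> i * std_error_sum eps (s n) i \<omega>)\<^sup>2)"
        "expectation (\<lambda>\<omega>. \<mu> i * std_error_sum eps (s n) i \<omega>) = 0"
        "expectation (\<lambda>\<omega>. (\<mu> i * std_error_sum eps (s n) i \<omega>)\<^sup>2) = (\<mu> i)\<^sup>2"
        using std_normal_moments(1)[OF D, of 2] std_normal_moments(2)[OF D, of 1]
          standard_normal_distributed_expectation[OF D]
        by (simp_all add: power_mult_distrib)
    qed
    show "prob {\<omega>\<in>space M.
        \<bar>(1 / real (p n)) * (\<Sum>i=1..p n. \<mu> i * std_error_sum eps (s n) i \<omega>)\<bar> \<ge> \<delta>}
        \<le> (\<Sum>i=1..p n. (\<mu> i)\<^sup>2) / (real (p n) * \<delta>)\<^sup>2"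
      using weak_law_bound[OF ind _ _ \<open>\<delta> > 0\<close>] mom by simp
  qed
qed simp

text \<open>Each \<open>sqrt s\<close> times a group mean equals \<open>sqrt s * \<mu> i\<close>
  plus a standardised error; squaring and averaging gives the three terms. The last is written as a
  centred average plus 1, so that the 1 cancels between \<open>s = r\<close> and
  \<open>s = k\<close>.\<close>

lemma mean_square_mle_decomp:
  assumes data: "\<And>i j. i \<ge> 1 \<Longrightarrow> j \<ge> 1 \<Longrightarrow> y i j \<omega> = \<mu> i + eps i j \<omega>"
    and "s \<ge> 1" "p \<ge> 1"
  shows "real s * mean_square_mle y p s \<omega> =
    real s * ((1 / real p) * (\<Sum>i=1..p. (\<mu> i)\<^sup>2))
    + 2 * sqrt (real s) * ((1 / real p) * (\<Sum>i=1..p. \<mu> i * std_error_sum eps s i \<omega>))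
    + ((1 / real p) * (\<Sum>i=1..p. (std_error_sum eps s i \<omega>)\<^sup>2 - 1) + 1)"
proof -
  let ?Z = "\<lambda>i. std_error_sum eps s i \<omega>"
  have sq: "real s * (group_mean y s i \<omega>)\<^sup>2 =
      real s * (\<mu> i)\<^sup>2 + 2 * sqrt (real s) * (\<mu> i * ?Z i) + (?Z i)\<^sup>2" if "i \<ge> 1" for i
  proof -
    have "(\<Sum>j=1..s. y i j \<omega>) = real s * \<mu> i + sqrt (real s) * ?Z i"
      using data that \<open>s \<ge> 1\<close> by (simp add: std_error_sum_def sum.distrib)
    then have gm: "group_mean y s i \<omega> = \<mu> i + ?Z i / sqrt (real s)"
      using \<open>s \<ge> 1\<close> by (simp add: group_mean_def field_simps)
    have rt: "sqrt (real s) * sqrt (real s) = real s" "sqrt (real s) > 0"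
      using \<open>s \<ge> 1\<close> by auto
    have "sqrt (real s) * group_mean y s i \<omega> = sqrt (real s) * \<mu> i + ?Z i"
      unfolding gm using rt(2) by (simp add: field_simps)
    then have "(sqrt (real s) * group_mean y s i \<omega>)\<^sup>2 = (sqrt (real s) * \<mu> i + ?Z i)\<^sup>2"
      by simp
    then show ?thesis
      by (simp add: power_mult_distrib power2_sum mult_ac)
  qed
  have "real s * mean_square_mle y p s \<omega> = (1 / real p) * (\<Sum>i=1..p. real s * (group_mean y s i \<omega>)\<^sup>2)"
    by (simp add: mean_square_mle_def sum_distrib_left)
  also have "(\<Sum>i=1..p. real s * (group_mean y s i \<omega>)\<^sup>2) =
      (\<Sum>i=1..p. real s * (\<mu> i)\<^sup>2 + 2 * sqrt (real s) * (\<mu> i * ?Z i) + (?Z i)\<^sup>2)"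
    by (intro sum.cong refl sq) simp
  also have "(1 / real p) * \<dots> = real s * ((1 / real p) * (\<Sum>i=1..p. (\<mu> i)\<^sup>2))
    + 2 * sqrt (real s) * ((1 / real p) * (\<Sum>i=1..p. \<mu> i * ?Z i))
    + ((1 / real p) * (\<Sum>i=1..p. (?Z i)\<^sup>2 - 1) + 1)"
    using \<open>p \<ge> 1\<close>
    unfolding sum.distrib sum_subtractf sum_distrib_left[symmetric]
    by (simp add: distrib_left right_diff_distrib)
  finally show ?thesis .
qed

section \<open>Consistency of the decision rule under both models\<close>

theorem theorem2:
  fixes M :: "'a measure"
    and eps y :: "nat \<Rightarrow> nat \<Rightarrow> 'a \<Rightarrow> real"
    and \<mu> :: "nat \<Rightarrow> real"
    and \<pi> :: "nat \<Rightarrow> (nat \<Rightarrow> real) \<Rightarrow> real"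
    and p k r :: "nat \<Rightarrow> nat"
    and c :: real
  assumes "prob_space M"
    and errors: "iid_std_normal_errors M eps"
    and data: "\<And>i j \<omega>. i \<ge> 1 \<Longrightarrow> j \<ge> 1 \<Longrightarrow> \<omega> \<in> space M \<Longrightarrow> y i j \<omega> = \<mu> i + eps i j \<omega>"
    and kr: "\<And>n. 1 \<le> k n \<and> k n < r n"
    and p_lim: "filterlim p at_top sequentially"
    and k_lim: "filterlim k at_top sequentially"
    and r_lim: "filterlim r at_top sequentially"
    and ratio: "(\<lambda>n. real (k n) / real (r n)) \<longlonglongrightarrow> c"
    and c: "0 \<le> c" "c < 1"
    and prior: "\<And>d. d \<ge> 1 \<Longrightarrow> prior_density d (\<pi> d)"
    and assumption1: "\<And>d. d \<ge> 1 \<Longrightarrow>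
          little_op_1 M (\<lambda>n \<omega>. \<pi> d (mle y d (k n) \<omega>) - \<pi> d (mle y d (r n) \<omega>))"
  shows "((\<forall>i\<ge>1. \<mu> i = 0) \<longrightarrow>
            (\<lambda>n. \<P>(\<omega> in M. log_CVBF_ps y (p n) (k n) (r n) \<omega> < 0)) \<longlonglongrightarrow> 1) \<and>
         (\<forall>\<tau>::real. \<tau>\<^sup>2 > 0 \<and> (\<lambda>d. (1 / real d) * (\<Sum>i=1..d. (\<mu> i)\<^sup>2)) \<longlonglongrightarrow> \<tau>\<^sup>2 \<longrightarrow>
            (\<lambda>n. \<P>(\<omega> in M. log_CVBF_ps y (p n) (k n) (r n) \<omega> > 0)) \<longlonglongrightarrow> 1)"
proof -
  interpret prob_space M by fact
  have r1: "\<And>n. r n \<ge> 1" and k1: "\<And>n. k n \<ge> 1"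
    using kr by (auto intro: less_imp_le le_less_trans)
  define V where "V s n \<omega> = (1 / real (p n)) * (\<Sum>i=1..p n. (std_error_sum eps s i \<omega>)\<^sup>2 - 1)"
    for s n \<omega>
  define U where "U s n \<omega> = (1 / real (p n)) * (\<Sum>i=1..p n. \<mu> i * std_error_sum eps s i \<omega>)"
    for s n \<omega>
  define m where "m d = (1 / real d) * (\<Sum>i=1..d. (\<mu> i)\<^sup>2)" for d
  \<comment> \<open>\<open>W\<close> is the bracket in the criterion; it has the sign of the
    criterion as soon as \<open>p n\<close> is positive.\<close>
  define W where "W n \<omega> = real (r n) * mean_square_mle y (p n) (r n) \<omega>
    - real (k n) * mean_square_mle y (p n) (k n) \<omega> - ln (real (r n) / real (k n))" for n \<omega>
  have [measurable]: "eps i j \<in> borel_measurable M" if "i \<ge> 1" "j \<ge> 1" for i j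
    using errors that by (auto simp: iid_std_normal_errors_def distributed_def)
  have [measurable]: "std_error_sum eps s i \<in> borel_measurable M" if "i \<ge> 1" for s i
    unfolding std_error_sum_def[abs_def] using that by measurable
  have [measurable]: "V s n \<in> borel_measurable M" "U s n \<in> borel_measurable M" for s n
    unfolding V_def[abs_def] U_def[abs_def] by measurable
  have p1: "\<forall>\<^sub>F n in sequentially. p n \<ge> 1"
    using p_lim by (simp add: filterlim_at_top)
  have log_eq: "log_CVBF_ps y (p n) (k n) (r n) \<omega> = real (p n) / 2 * W n \<omega>" for n \<omega>
    by (simp add: log_CVBF_ps_def W_def)
  have W: "W n \<omega> = (real (r n) - real (k n)) * m (p n)
      + 2 * sqrt (real (r n)) * U (r n) n \<omega> - 2 * sqrt (real (k n)) * U (k n) n \<omega>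
      + V (r n) n \<omega> - V (k n) n \<omega> - ln (real (r n) / real (k n))"
    if "p n \<ge> 1" "\<omega> \<in> space M" for n \<omega>
    using mean_square_mle_decomp[of y \<omega> \<mu> eps, OF data[OF _ _ that(2)] r1 that(1), of n]
      mean_square_mle_decomp[of y \<omega> \<mu> eps, OF data[OF _ _ that(2)] k1 that(1), of n]
    unfolding W_def U_def[symmetric] V_def[symmetric] m_def[symmetric] by (simp add: algebra_simps)
  \<comment> \<open>The data equation is known only on \<open>space M\<close>, so measurability is
    transferred by congruence there.\<close>
  have [measurable]: "y i j \<in> borel_measurable M" if "i \<ge> 1" "j \<ge> 1" for i j
    using that data by (subst measurable_cong[where g = "\<lambda>\<omega>. \<mu> i + eps i j \<omega>"]) auto
  have [measurable]: "log_CVBF_ps y d a b \<in> borel_measurable M" for d a b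
    unfolding log_CVBF_ps_def[abs_def] mean_square_mle_def group_mean_def by measurable
  have V_lim: "(\<lambda>n. prob ({\<omega>\<in>space M. \<bar>V (r n) n \<omega>\<bar> \<ge> \<delta>} \<union> {\<omega>\<in>space M. \<bar>V (k n) n \<omega>\<bar> \<ge> \<delta>}))
      \<longlonglongrightarrow> 0" if "\<delta> > 0" for \<delta>
    using mean_square_errors_concentrate[where s=r, OF errors r1 p_lim that]
      mean_square_errors_concentrate[where s=k, OF errors k1 p_lim that]
    by (intro prob_Un_tendsto_0) (simp_all add: V_def)
  \<comment> \<open>The midpoint of \<open>c\<close> and 1 leaves room above the limit ratio and is
    positive even for \<open>c = 0\<close>, so that \<open>ln q\<close> and \<open>1 / q\<close> are
    usable.\<close>
  define q where "q = (1 + c) / 2"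
  have q: "0 < q" "q < 1" "c < q"
    using c by (auto simp: q_def)
  have kq: "\<forall>\<^sub>F n in sequentially. real (k n) < q * real (r n)"
    using order_tendstoD(2)[OF ratio q(3)]
  proof eventually_elim
    case (elim n)
    then show ?case using r1[of n] by (simp add: field_simps)
  qed

  have M1: "(\<lambda>n. prob {\<omega>\<in>space M. log_CVBF_ps y (p n) (k n) (r n) \<omega> < 0}) \<longlonglongrightarrow> 1"
    if \<mu>0: "\<forall>i\<ge>1. \<mu> i = 0"
  proof -
    \<comment> \<open>Off the bad event the two \<open>V\<close> terms differ by less than
      \<open>2 * \<delta> = ln (1 / q)\<close>, which is eventually below the penalty
      \<open>ln (r / k)\<close>.\<close>
    define \<delta> where "\<delta> = - ln q / 2"
    have "\<delta> > 0" using q by (simp add: \<delta>_def)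
    show ?thesis
    proof (rule prob_tendsto_1[OF V_lim[OF \<open>\<delta> > 0\<close>]])
      show "\<forall>\<^sub>F n in sequentially. space M -
          ({\<omega>\<in>space M. \<bar>V (r n) n \<omega>\<bar> \<ge> \<delta>} \<union> {\<omega>\<in>space M. \<bar>V (k n) n \<omega>\<bar> \<ge> \<delta>})
          \<subseteq> {\<omega>\<in>space M. log_CVBF_ps y (p n) (k n) (r n) \<omega> < 0}"
        using p1 kq
      proof eventually_elim
        case (elim n)
        have pos: "real (k n) > 0" "real (r n) > 0" using k1[of n] r1[of n] by auto
        have "1 / q < real (r n) / real (k n)"
          using elim(2) pos q by (simp add: field_simps)
        then have "ln (1 / q) < ln (real (r n) / real (k n))"
          using pos q by (subst ln_less_cancel_iff) auto
        then have ln: "2 * \<delta> < ln (real (r n) / real (k n))"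
          using q by (simp add: \<delta>_def ln_div)
        have "U s n \<omega> = 0" "m (p n) = 0" for s \<omega>
          using \<mu>0 by (auto simp: U_def m_def)
        then show ?case
          using W[OF elim(1)] ln elim(1) by (auto simp: log_eq mult_less_0_iff not_le)
      qed
    qed measurable
  qed

  have M2: "(\<lambda>n. prob {\<omega>\<in>space M. log_CVBF_ps y (p n) (k n) (r n) \<omega> > 0}) \<longlonglongrightarrow> 1"
    if \<tau>: "\<tau>\<^sup>2 > 0" "m \<longlonglongrightarrow> \<tau>\<^sup>2" for \<tau> :: real
  proof -
    \<comment> \<open>The threshold 1 is enough here: bounded \<open>U\<close> and \<open>V\<close>
      contribute only order \<open>sqrt r\<close>, against a signal of order at least
      \<open>r\<close>.\<close>
    have "(\<lambda>n. prob ({\<omega>\<in>space M. \<bar>U (r n) n \<omega>\<bar> \<ge> 1} \<union> {\<omega>\<in>space M. \<bar>U (k n) n \<omega>\<bar> \<ge> 1})) \<longlonglongrightarrow> 0"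
      using weighted_mean_errors_concentrate[where s=r and \<mu>=\<mu>, OF errors r1 p_lim zero_less_one]
        weighted_mean_errors_concentrate[where s=k and \<mu>=\<mu>, OF errors k1 p_lim zero_less_one]
        \<tau>(2)
      by (intro prob_Un_tendsto_0) (simp_all add: U_def m_def[abs_def])
    then have bad: "(\<lambda>n. prob (
        ({\<omega>\<in>space M. \<bar>U (r n) n \<omega>\<bar> \<ge> 1} \<union> {\<omega>\<in>space M. \<bar>U (k n) n \<omega>\<bar> \<ge> 1}) \<union>
        ({\<omega>\<in>space M. \<bar>V (r n) n \<omega>\<bar> \<ge> 1} \<union> {\<omega>\<in>space M. \<bar>V (k n) n \<omega>\<bar> \<ge> 1}))) \<longlonglongrightarrow> 0"
      by (rule prob_Un_tendsto_0[OF _ V_lim]) simp_all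
    have m_low: "\<forall>\<^sub>F n in sequentially. m (p n) > \<tau>\<^sup>2 / 2"
      using filterlim_compose[OF \<tau>(2) p_lim] \<tau>(1) by (intro order_tendstoD(1)) auto
    \<comment> \<open>The signal \<open>(r - k) * m\<close> is eventually at least
      \<open>r * a\<close>, from \<open>k < q * r\<close> and
      \<open>m > \<tau>\<^sup>2 / 2\<close>.\<close>
    define a where "a = (1 - q) * \<tau>\<^sup>2 / 2"
    have "a > 0" using q \<tau>(1) by (simp add: a_def)
    then have "\<forall>\<^sub>F x::real in at_top. x * a > 4 * sqrt x + 2 + ln x"
      by real_asymp
    \<comment> \<open>The right side collects the worst case: \<open>2 * sqrt r\<close> for each of
      the two \<open>U\<close> terms, 1 for each \<open>V\<close> term, and \<open>ln r\<close> for
      the penalty.\<close>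
    then have growth: "\<forall>\<^sub>F n in sequentially.
        real (r n) * a > 4 * sqrt (real (r n)) + 2 + ln (real (r n))"
      by (rule eventually_compose_filterlim[OF _ filterlim_compose[OF filterlim_real_sequentially r_lim]])
    show ?thesis
    proof (rule prob_tendsto_1[OF bad])
      show "\<forall>\<^sub>F n in sequentially. space M -
          (({\<omega>\<in>space M. \<bar>U (r n) n \<omega>\<bar> \<ge> 1} \<union> {\<omega>\<in>space M. \<bar>U (k n) n \<omega>\<bar> \<ge> 1}) \<union>
           ({\<omega>\<in>space M. \<bar>V (r n) n \<omega>\<bar> \<ge> 1} \<union> {\<omega>\<in>space M. \<bar>V (k n) n \<omega>\<bar> \<ge> 1}))
          \<subseteq> {\<omega>\<in>space M. log_CVBF_ps y (p n) (k n) (r n) \<omega> > 0}"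
        using p1 kq m_low growth
      proof eventually_elim
        case (elim n)
        have pos: "real (k n) \<ge> 1" "real (r n) \<ge> 1" "real (k n) \<le> real (r n)"
          using k1[of n] r1[of n] kr[of n] by auto
        have "(1 - q) * real (r n) * (\<tau>\<^sup>2 / 2) \<le> (real (r n) - real (k n)) * m (p n)"
          using elim(2,3) q \<tau>(1) pos by (intro mult_mono) (auto simp: algebra_simps)
        then have main: "real (r n) * a \<le> (real (r n) - real (k n)) * m (p n)"
          by (simp add: a_def mult_ac)
        \<comment> \<open>Only \<open>k \<ge> 1\<close> enters; for \<open>c = 0\<close> the ratio
          \<open>r / k\<close> is unbounded, but \<open>ln r\<close> is still negligible against
          \<open>r\<close>.\<close>
        have ln: "ln (real (r n) / real (k n)) \<le> ln (real (r n))"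
          using pos by (simp add: ln_div)
        have bound: "\<bar>2 * sqrt (real s) * u\<bar> \<le> 2 * sqrt (real (r n))"
          if "s \<le> r n" "\<bar>u\<bar> < 1" for s and u :: real
        proof -
          have "sqrt (real s) * \<bar>u\<bar> \<le> sqrt (real (r n)) * 1"
            using that by (intro mult_mono) auto
          then show ?thesis by (simp add: abs_mult)
        qed
        show ?case
        proof
          fix \<omega>
          assume \<omega>: "\<omega> \<in> space M -
            (({\<omega>\<in>space M. \<bar>U (r n) n \<omega>\<bar> \<ge> 1} \<union> {\<omega>\<in>space M. \<bar>U (k n) n \<omega>\<bar> \<ge> 1}) \<union>
             ({\<omega>\<in>space M. \<bar>V (r n) n \<omega>\<bar> \<ge> 1} \<union> {\<omega>\<in>space M. \<bar>V (k n) n \<omega>\<bar> \<ge> 1}))"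
          then have in_space: "\<omega> \<in> space M"
            and small: "\<bar>U (r n) n \<omega>\<bar> < 1" "\<bar>U (k n) n \<omega>\<bar> < 1" "\<bar>V (r n) n \<omega>\<bar> < 1" "\<bar>V (k n) n \<omega>\<bar> < 1"
            by auto
          have "W n \<omega> > 0"
            using W[OF elim(1) in_space] main ln elim(4) small(3,4)
              bound[OF _ small(1)] bound[OF _ small(2)] pos(3) by fastforce
          then show "\<omega> \<in> {\<omega>\<in>space M. log_CVBF_ps y (p n) (k n) (r n) \<omega> > 0}"
            using in_space elim(1) by (simp add: log_eq)
        qed
      qed
    qed measurable
  qed

  show ?thesis
    using M1 M2 unfolding m_def[abs_def] by blast
qed

end
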